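(* Let $v$ be a positive integer with $v\equiv 0$ or $2\pmod 3$ and $v\ne 3$, and let $H$ be a Hadamard matrix of order $v^2$. (i) There exists a block-symmetric $\mathcal{C}^3_3\big(v^3,\ v^4(v^2-1)/2,\ v^4(v^2-2)/4\big)$-cube. (ii) If $H$ is regular, there exists a block-symmetric $\mathcal{C}^3_3\big(v^3,\ v^3(v^3-1)/2,\ v^3(v^3-2)/4\big)$-cube.
   Context: A $w\times w\times w$ array is a function on $\{1,\dots,w\}^3$. A layer is obtained by fixing one of the three coordinates; two layers are parallel if they fix the same coordinate, to different values; their scalar product is the sum over all positions of the product of corresponding entries. $\mathcal{C}^3_3(w,k,\lambda)$ is the set of $w\times w\times w$ arrays over $\{0,1\}$ such that every layer (in each of the three directions) contains exactly $k$ ones and every two parallel layers have scalar product $\lambda$; its elements are called $\mathcal{C}^3_3(w,k,\lambda)$-cubes. A Hadamard matrix of order $n$ is an $n\times n$ matrix over $\{1,-1\}$ whose distinct rows are orthogonal and whose distinct columns are orthogonal; it is regular if all its row sums and column sums are equal to each other. A cube $A\in\mathcal{C}^3_3(v^3,k,\lambda)$ of order $v^3$ is block-symmetric if, partitioning $\{1,\dots,v^3\}$ into $v$ consecutive intervals of length $v^2$ and letting $A_{ij\ell}$ ($i,j,\ell\in\{1,\dots,v\}$) be the $v^2\times v^2\times v^2$ array $A_{ij\ell}(a,b,c)=A\big(v^2(i-1)+a,\ v^2(j-1)+b,\ v^2(\ell-1)+c\big)$, one has (1) $A_{ij\ell}=A_{j\ell i}=A_{\ell ij}$ for distinct $i,j,\ell\in\{1,\dots,v\}$;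 (2) $A_{iij}=A_{jji}$, $A_{iji}=A_{jij}$, $A_{ijj}=A_{jii}$ for all $i,j\in\{1,\dots,v\}$. *)

theory Defs
  imports Jordan_Normal_Form.Matrix "HOL-Library.FuncSet"
begin

definition hadamard_matrix :: "nat \<Rightarrow> int mat \<Rightarrow> bool" where
  "hadamard_matrix n H \<longleftrightarrow>
     H \<in> carrier_mat n n \<and> elements_mat H \<subseteq> {1, -1} \<and>
     (\<forall>i<n. \<forall>j<n. i \<noteq> j \<longrightarrow> row H i \<bullet> row H j = 0) \<and>
     (\<forall>i<n. \<forall>j<n. i \<noteq> j \<longrightarrow> col H i \<bullet> col H j = 0)"

definition regular_hadamard_matrix :: "nat \<Rightarrow> int mat \<Rightarrow> bool" where
  "regular_hadamard_matrix n H \<longleftrightarrow>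
     hadamard_matrix n H \<and>
     (\<exists>s. (\<forall>i<n. (\<Sum>j<n. H $$ (i, j)) = s) \<and> (\<forall>j<n. (\<Sum>i<n. H $$ (i, j)) = s))"

definition positions :: "nat \<Rightarrow> (nat \<times> nat \<times> nat) set" where
  "positions w = {1..w} \<times> {1..w} \<times> {1..w}"

text \<open>The layer of \<open>A\<close> obtained by fixing coordinate \<open>d \<in> {1, 2, 3}\<close> to the value \<open>c\<close>,
  indexed by the two remaining coordinates in their original order.\<close>

definition layer :: "(nat \<times> nat \<times> nat \<Rightarrow> nat) \<Rightarrow> nat \<Rightarrow> nat \<Rightarrow> nat \<times> nat \<Rightarrow> nat" where
  "layer A d c = (\<lambda>(a, b).
     if d = 1 then A (c, a, b) else if d = 2 then A (a, c, b) else A (a, b, c))"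

text \<open>Arrays are extensional functions, so that an array carries no data outside its index set
  and equality of arrays is equality of functions.\<close>

definition C33 :: "nat \<Rightarrow> nat \<Rightarrow> nat \<Rightarrow> (nat \<times> nat \<times> nat \<Rightarrow> nat) set" where
  "C33 w k l = {A \<in> positions w \<rightarrow>\<^sub>E {0, 1}.
     \<forall>d\<in>{1, 2, 3}.
       (\<forall>c\<in>{1..w}. card {p \<in> {1..w} \<times> {1..w}. layer A d c p = 1} = k) \<and>
       (\<forall>c\<in>{1..w}. \<forall>c'\<in>{1..w}. c \<noteq> c' \<longrightarrow>
          (\<Sum>p\<in>{1..w} \<times> {1..w}. layer A d c p * layer A d c' p) = l)}"

definition block ::
  "nat \<Rightarrow> (nat \<times> nat \<times> nat \<Rightarrow> nat) \<Rightarrow> nat \<Rightarrow> nat \<Rightarrow> nat \<Rightarrow> nat \<times> nat \<times> nat \<Rightarrow> nat" where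
  "block v A i j l = (\<lambda>(a, b, c) \<in> positions (v^2).
     A (v^2 * (i - 1) + a, v^2 * (j - 1) + b, v^2 * (l - 1) + c))"

definition block_symmetric :: "nat \<Rightarrow> (nat \<times> nat \<times> nat \<Rightarrow> nat) \<Rightarrow> bool" where
  "block_symmetric v A \<longleftrightarrow>
     (\<forall>i\<in>{1..v}. \<forall>j\<in>{1..v}. \<forall>l\<in>{1..v}. i \<noteq> j \<and> j \<noteq> l \<and> i \<noteq> l \<longrightarrow>
        block v A i j l = block v A j l i \<and> block v A j l i = block v A l i j) \<and>
     (\<forall>i\<in>{1..v}. \<forall>j\<in>{1..v}.
        block v A i i j = block v A j j i \<and>
        block v A i j i = block v A j i j \<and>
        block v A i j j = block v A j i i)"

text \<open>The parameters \<open>k\<close> and \<open>l\<close> of \<^const>\<open>C33\<close> will be quotients of natural numbers. For even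
  \<open>v\<close> they are integers, and no Hadamard matrix of odd order \<open>v^2 > 1\<close> exists, so that
  the truncation in \<open>div\<close> is never active there.\<close>

end

theory Submission
  imports Defs
begin

text \<open>
  Replace the symbol \<open>e\<close> of a \<open>v \<times> v \<times> v\<close> array over \<open>v\<^sup>2\<close> symbols by the rank-one sign array
  \<open>h\<^sub>e \<otimes> h\<^sub>e \<otimes> h\<^sub>e\<close>, where \<open>h\<^sub>e\<close> is row \<open>e\<close> of a Hadamard matrix. If every layer of the
  symbol array contains each symbol exactly once, then orthogonality of columns makes two
  layers through the same blocks orthogonal, and orthogonality of rows does so for layers through
  different blocks. A layer with inner index \<open>a\<close> has sum \<open>\<Sum>\<^sub>e h\<^sub>e(a) (\<Sum>\<^sub>b h\<^sub>e(b))\<^sup>2\<close>, which is \<open>-v\<^sup>4\<close>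
  when row \<open>0\<close> of \<open>h\<close> is normalised to \<open>-1\<close>, and \<open>-v\<^sup>3\<close> when \<open>h\<close> is regular with row sum \<open>-v\<close>.

  Block symmetry requires the cells of the symbol array with the same \<open>kind\<close> (equality pattern or
  cyclic orientation) and the same underlying set to carry the same symbol. Hence a symbol
  class is a partition of the \<open>v\<close> points into singletons, pairs (of three kinds) and triples (of two
  kinds). As \<open>v\<close> is even, such partitions come from Baranyai's theorem for pairs on \<open>v\<close> points
  and for triples on \<open>v\<close> or \<open>v + 1\<close> points.
\<close>

section \<open>Transversals\<close>

text \<open>Induction on the family: either some nonempty proper subfamily is tight and can be
  matched separately from the rest, or every such subfamily has a spare element and one match can be
  made freely.\<close>

theorem hall_marriage:
  assumes "finite I" "\<And>i. i \<in> I \<Longrightarrow> finite (A i)"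
    and "\<And>J. J \<subseteq> I \<Longrightarrow> card J \<le> card (\<Union>i\<in>J. A i)"
  shows "\<exists>f. inj_on f I \<and> (\<forall>i\<in>I. f i \<in> A i)"
  using assms
proof (induction "card I" arbitrary: I A rule: less_induct)
  case less
  show ?case
  proof (cases "I = {}")
    case False
    show ?thesis
    proof (cases "\<exists>J. J \<noteq> {} \<and> J \<subset> I \<and> card (\<Union>i\<in>J. A i) = card J")
      case True
      then obtain J where J: "J \<noteq> {}" "J \<subset> I" "card (\<Union>i\<in>J. A i) = card J" by blast
      have finJ: "finite J" using J(2) less.prems(1) finite_subset by blast
      have "card J < card I" using J(2) less.prems(1) by (simp add: psubset_card_mono)
      then obtain f where f: "inj_on f J" "\<forall>i\<in>J. f i \<in> A i"
        using less.hyps[of J A] finJ J(2) less.prems by blast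
      define U where "U = (\<Union>i\<in>J. A i)"
      have finU: "finite U" unfolding U_def using finJ J(2) less.prems(2) by blast
      \<comment> \<open>\<open>K \<union> J\<close> has enough neighbours and exactly
        \<open>card J\<close> of them lie in \<open>U\<close>, so at least \<open>card K\<close>
        remain outside.\<close>
      have cond: "card K \<le> card (\<Union>i\<in>K. A i - U)" if K: "K \<subseteq> I - J" for K
      proof -
        have finK: "finite K" using K less.prems(1) finite_subset by blast
        have "card K + card J = card (K \<union> J)"
          using K finK finJ by (subst card_Un_disjoint) auto
        also have "\<dots> \<le> card (\<Union>i\<in>K \<union> J. A i)"
          using K J(2) by (intro less.prems(3)) blast
        also have "(\<Union>i\<in>K \<union> J. A i) = (\<Union>i\<in>K. A i - U) \<union> U"
          unfolding U_def by blast
        also have "card \<dots> = card (\<Union>i\<in>K. A i - U) + card U"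
          using finK finU K less.prems(2) by (intro card_Un_disjoint) auto
        finally show ?thesis using J(3) U_def by simp
      qed
      have "card (I - J) < card I"
        using J(1,2) less.prems(1) by (intro psubset_card_mono) auto
      then obtain g where g: "inj_on g (I - J)" "\<forall>i\<in>I - J. g i \<in> A i - U"
        using less.hyps[of "I - J" "\<lambda>i. A i - U"] less.prems(1,2) cond by auto
      have fU: "\<And>i. i \<in> J \<Longrightarrow> f i \<in> U" unfolding U_def using f(2) by blast
      have "inj_on (\<lambda>i. if i \<in> J then f i else g i) I"
      proof (rule inj_onI)
        fix x y assume xy: "x \<in> I" "y \<in> I"
          "(if x \<in> J then f x else g x) = (if y \<in> J then f y else g y)"
        show "x = y"
          using xy f g fU by (cases "x \<in> J"; cases "y \<in> J") (auto dest: inj_onD; metis DiffE DiffI)+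
      qed
      moreover have "\<forall>i\<in>I. (if i \<in> J then f i else g i) \<in> A i" using f g by auto
      ultimately show ?thesis by blast
    next
      case no: False
      obtain i where i: "i \<in> I" using False by blast
      have "card {i} \<le> card (A i)" using less.prems(3)[of "{i}"] i by simp
      then have "A i \<noteq> {}" by auto
      then obtain x where x: "x \<in> A i" by blast
      \<comment> \<open>No nonempty proper subfamily is tight, so a surplus of at least one absorbs
        the loss of \<open>x\<close>.\<close>
      have cond: "card K \<le> card (\<Union>j\<in>K. A j - {x})" if K: "K \<subseteq> I - {i}" for K
      proof (cases "K = {}")
        case False
        have "K \<subset> I" using K i by blast
        then have "card K \<noteq> card (\<Union>j\<in>K. A j)" using no False by metis
        moreover have "card K \<le> card (\<Union>j\<in>K. A j)" using less.prems(3) \<open>K \<subset> I\<close> by blast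
        ultimately have "card K < card (\<Union>j\<in>K. A j)" by simp
        moreover have "(\<Union>j\<in>K. A j - {x}) = (\<Union>j\<in>K. A j) - {x}" by blast
        ultimately show ?thesis by (simp add: card_Diff_singleton_if, arith)
      qed simp
      have "card (I - {i}) < card I" using i less.prems(1) by (meson card_Diff1_less)
      then obtain g where g: "inj_on g (I - {i})" "\<forall>j\<in>I - {i}. g j \<in> A j - {x}"
        using less.hyps[of "I - {i}" "\<lambda>j. A j - {x}"] less.prems(1,2) cond by auto
      have "inj_on (g(i := x)) I"
        using g by (auto simp: inj_on_def)
      moreover have "\<forall>j\<in>I. (g(i := x)) j \<in> A j" using g x by auto
      ultimately show ?thesis by blast
    qed
  qed auto
qed

text \<open>Divided by \<open>q\<close>, \<open>w\<close> is a fractional assignment of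
  \<open>I\<close> to places \<open>x\<close> of capacity \<open>d x\<close>. Replacing each
  \<open>x\<close> by \<open>d x\<close> copies turns an integral assignment within the support of
  \<open>w\<close> into a system of distinct representatives.\<close>

lemma integral_transversal:
  fixes w :: "'a \<Rightarrow> 'b \<Rightarrow> nat"
  assumes "finite I" "finite X" "q > 0"
    and row: "\<And>i. i \<in> I \<Longrightarrow> (\<Sum>x\<in>X. w i x) = q"
    and col: "\<And>x. x \<in> X \<Longrightarrow> (\<Sum>i\<in>I. w i x) = q * d x"
  obtains f where "\<And>i. i \<in> I \<Longrightarrow> f i \<in> X \<and> w i (f i) > 0"
    and "\<And>x. x \<in> X \<Longrightarrow> card {i\<in>I. f i = x} = d x"
proof -
  define A where "A i = (SIGMA x:{x\<in>X. w i x > 0}. {..<d x})" for i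
  have "card J \<le> card (\<Union>i\<in>J. A i)" if J: "J \<subseteq> I" for J
  proof -
    define N where "N = {x\<in>X. \<exists>i\<in>J. w i x > 0}"
    \<comment> \<open>Hall's condition by double counting: the weight \<open>q * card J\<close> sent
      out by \<open>J\<close> all arrives in \<open>N\<close>, which receives
      \<open>q * (\<Sum>x\<in>N. d x)\<close> in total.\<close>
    have "q * card J = (\<Sum>i\<in>J. \<Sum>x\<in>X. w i x)"
      using row J by (simp add: subset_iff)
    also have "\<dots> = (\<Sum>i\<in>J. \<Sum>x\<in>N. w i x)"
      by (intro sum.cong refl sum.mono_neutral_right) (auto simp: N_def assms(2))
    also have "\<dots> = (\<Sum>x\<in>N. \<Sum>i\<in>J. w i x)" by (rule sum.swap)
    also have "\<dots> \<le> (\<Sum>x\<in>N. \<Sum>i\<in>I. w i x)"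
      using J assms(1) by (intro sum_mono sum_mono2) auto
    also have "\<dots> = q * (\<Sum>x\<in>N. d x)"
      using col by (simp add: N_def sum_distrib_left)
    also have "(\<Sum>x\<in>N. d x) = card (SIGMA x:N. {..<d x})"
      using assms(2) by (simp add: N_def)
    also have "(SIGMA x:N. {..<d x}) = (\<Union>i\<in>J. A i)"
      unfolding N_def A_def by auto
    finally show ?thesis using assms(3) by simp
  qed
  moreover have "finite (A i)" for i unfolding A_def using assms(2) by auto
  ultimately obtain F where F: "inj_on F I" "\<forall>i\<in>I. F i \<in> A i"
    using hall_marriage[OF assms(1), of A] by blast
  define f where "f i = fst (F i)" for i
  have f: "f i \<in> X \<and> w i (f i) > 0" if "i \<in> I" for i
    using F(2) that unfolding A_def f_def by fastforce
  have le: "card {i\<in>I. f i = x} \<le> d x" for x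
  proof -
    have "card {i\<in>I. f i = x} = card (F ` {i\<in>I. f i = x})"
      using F(1) by (intro card_image[symmetric]) (auto simp: inj_on_def)
    also have "\<dots> \<le> card ({x} \<times> {..<d x})"
      using F(2) unfolding A_def f_def by (intro card_mono) (force, fastforce)
    finally show ?thesis by simp
  qed
  \<comment> \<open>The capacities add up to \<open>card I\<close>, so the upper bounds
    \<open>le\<close> on the fibres must all be equalities.\<close>
  have "q * (\<Sum>x\<in>X. d x) = (\<Sum>x\<in>X. \<Sum>i\<in>I. w i x)"
    by (simp add: col sum_distrib_left)
  also have "\<dots> = (\<Sum>i\<in>I. \<Sum>x\<in>X. w i x)" by (rule sum.swap)
  also have "\<dots> = q * card I" by (simp add: row)
  finally have "(\<Sum>x\<in>X. d x) = card I" using assms(3) by simp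
  also have "\<dots> = (\<Sum>x\<in>X. card {i\<in>I. f i = x})"
    using sum.group[OF assms(1,2), of f "\<lambda>_. 1::nat"] f by fastforce
  finally have eq: "(\<Sum>x\<in>X. card {i\<in>I. f i = x}) = (\<Sum>x\<in>X. d x)" by simp
  have "card {i\<in>I. f i = x} = d x" if "x \<in> X" for x
    using sum_mono_inv[OF eq le that assms(2)] .
  with f that show ?thesis by blast
qed

section \<open>Baranyai's theorem\<close>

definition part :: "(nat \<Rightarrow> nat \<Rightarrow> nat) \<Rightarrow> nat \<Rightarrow> nat \<Rightarrow> nat \<Rightarrow> nat set" where
  "part c l i p = {x. x < l \<and> c i x = p}"

text \<open>The state after distributing \<open>l\<close> points: \<open>M\<close> ordered partitions of \<open>{..<l}\<close> into \<open>m\<close> possibly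
  empty parts, with \<open>c i x\<close> the part of the \<open>i\<close>th partition containing \<open>x\<close>. A set \<open>S\<close> occurs as often as
  it is the trace on \<open>{..<l}\<close> of a \<open>k\<close>-subset of the full set of \<open>m * k\<close> points.\<close>

definition baranyai_stage :: "nat \<Rightarrow> nat \<Rightarrow> nat \<Rightarrow> nat \<Rightarrow> (nat \<Rightarrow> nat \<Rightarrow> nat) \<Rightarrow> bool" where
  "baranyai_stage k m M l c \<longleftrightarrow>
     (\<forall>i<M. \<forall>x<l. c i x < m) \<and>
     (\<forall>S\<subseteq>{..<l}. card {(i, p). i < M \<and> p < m \<and> part c l i p = S} =
        (if card S \<le> k then (m * k - l) choose (k - card S) else 0))"

lemma finite_part [simp]: "finite (part c l i p)"
  unfolding part_def by simp

text \<open>Putting the point \<open>l\<close> into a part \<open>S\<close> with weight \<open>(k - card S) / (m * k - l)\<close> is a fractional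
  solution of the extension problem; Hall's theorem makes it integral.\<close>

lemma baranyai_stage_Suc:
  assumes st: "baranyai_stage k m M l c" and l: "l < m * k"
  obtains c' where "baranyai_stage k m M (Suc l) c'"
proof -
  \<comment> \<open>\<open>d S\<close> is the number of parts equal to \<open>S\<close> that must
    receive \<open>l\<close>: the \<open>k\<close>-subsets of all \<open>m * k\<close> points with
    trace \<open>insert l S\<close> on \<open>{..<Suc l}\<close> are counted by their points beyond
    \<open>l\<close>.\<close>
  define d where "d S = (if card S < k then (m * k - Suc l) choose (k - Suc (card S)) else 0)"
    for S :: "nat set"
  \<comment> \<open>The denominator \<open>m * k - l\<close> is cleared to keep weights integral.
    The first factor can exceed one only for the empty part.\<close>
  define w where "w i S = card {p. p < m \<and> part c l i p = S} * (k - card S)" for i S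
  have cnt: "card {(i, p). i < M \<and> p < m \<and> part c l i p = S} =
        (if card S \<le> k then (m * k - l) choose (k - card S) else 0)" if "S \<subseteq> {..<l}" for S
    using st that unfolding baranyai_stage_def by blast
  have fin: "finite {(i, p). i < M \<and> p < m \<and> P i p}" for P
    by (rule finite_subset[of _ "{..<M} \<times> {..<m}"]) auto
  have sub: "part c l i p \<subseteq> {..<l}" for i p unfolding part_def by auto
  \<comment> \<open>Sets larger than \<open>k\<close> occur zero times by \<open>cnt\<close>, so the
    differences \<open>k - card S\<close> are not truncated on parts.\<close>
  have small: "card (part c l i p) \<le> k" if "i < M" "p < m" for i p
  proof (rule ccontr)
    assume "\<not> card (part c l i p) \<le> k"
    then have "card {(j, r). j < M \<and> r < m \<and> part c l j r = part c l i p} = 0"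
      using cnt[OF sub] by simp
    with fin[of "\<lambda>j r. part c l j r = part c l i p"] that show False by auto
  qed
  have row: "(\<Sum>S\<in>Pow {..<l}. w i S) = m * k - l" if i: "i < M" for i
  proof -
    have "(\<Sum>S\<in>Pow {..<l}. w i S) =
        (\<Sum>S\<in>Pow {..<l}. \<Sum>p\<in>{p \<in> {..<m}. part c l i p = S}. k - card (part c l i p))"
      unfolding w_def by (intro sum.cong refl) (simp add: lessThan_def)
    also have "\<dots> = (\<Sum>p<m. k - card (part c l i p))"
      using sub by (intro sum.group) auto
    finally have 1: "(\<Sum>S\<in>Pow {..<l}. w i S) = (\<Sum>p<m. k - card (part c l i p))" .
    have "(\<Sum>p<m. k - card (part c l i p)) + (\<Sum>p<m. card (part c l i p)) = (\<Sum>p<m. k)"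
      unfolding sum.distrib[symmetric] by (intro sum.cong refl) (use small i in auto)
    moreover have "(\<Sum>p<m. card (part c l i p)) = l"
    proof -
      have "(\<Sum>p<m. card {x \<in> {..<l}. c i x = p}) = card {..<l}"
        using sum.group[of "{..<l}" "{..<m}" "c i" "\<lambda>_. 1::nat"] st i
        unfolding baranyai_stage_def by fastforce
      then show ?thesis unfolding part_def by simp
    qed
    ultimately show ?thesis using 1 by simp
  qed
  have col: "(\<Sum>i<M. w i S) = (m * k - l) * d S" if S: "S \<in> Pow {..<l}" for S
  proof -
    have "(\<Sum>i<M. card {p. p < m \<and> part c l i p = S}) =
        card (SIGMA i:{..<M}. {p. p < m \<and> part c l i p = S})"
      by simp
    also have "(SIGMA i:{..<M}. {p. p < m \<and> part c l i p = S}) =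
        {(i, p). i < M \<and> p < m \<and> part c l i p = S}" by auto
    finally have "(\<Sum>i<M. w i S) =
        (if card S \<le> k then (m * k - l) choose (k - card S) else 0) * (k - card S)"
      unfolding w_def sum_distrib_right[symmetric] using cnt S by simp
    \<comment> \<open>Absorption:
      \<open>Suc e * (Suc r choose Suc e) = Suc r * (r choose e)\<close>.\<close>
    also have "\<dots> = (m * k - l) * d S"
    proof (cases "card S < k")
      case True
      then obtain e where e: "k - card S = Suc e" "k - Suc (card S) = e"
        by (metis Suc_diff_Suc)
      obtain r where r: "m * k - l = Suc r" "m * k - Suc l = r"
        using l by (metis Suc_diff_Suc)
      show ?thesis using True binomial_absorption[of e "Suc r"] unfolding d_def e r by (simp add: mult.commute)
    next
      case False
      then show ?thesis unfolding d_def by simp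
    qed
    finally show ?thesis .
  qed
  obtain f where f: "\<And>i. i \<in> {..<M} \<Longrightarrow> f i \<in> Pow {..<l} \<and> w i (f i) > 0"
    and fd: "\<And>S. S \<in> Pow {..<l} \<Longrightarrow> card {i\<in>{..<M}. f i = S} = d S"
    using integral_transversal[of "{..<M}" "Pow {..<l}" "m * k - l" w d] row col l by auto
  have "\<exists>p. p < m \<and> part c l i p = f i" if "i < M" for i
  proof -
    have "{p. p < m \<and> part c l i p = f i} \<noteq> {}"
      using f[of i] that unfolding w_def by (metis card.empty lessThan_iff mult_0 not_gr0)
    then show ?thesis by blast
  qed
  then obtain g where g: "\<And>i. i < M \<Longrightarrow> g i < m \<and> part c l i (g i) = f i" by metis
  define c' where "c' i x = (if x = l then g i else c i x)" for i x
  have part': "part c' (Suc l) i p = (if p = g i then insert l (part c l i p) else part c l i p)"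
    for i p unfolding part_def c'_def by auto
  have notin: "l \<notin> part c l i p" for i p unfolding part_def by simp
  have ins: "part c l i p \<noteq> insert l S" for i p S using notin by blast
  have ins_eq: "insert l (part c l i p) = insert l S \<longleftrightarrow> part c l i p = S" if "l \<notin> S" for i p S
    using notin that by (simp add: insert_ident)
  have gcard: "card {(i, p). i < M \<and> p = g i \<and> f i = S} = d S" if "S \<subseteq> {..<l}" for S
  proof -
    have "{(i, p). i < M \<and> p = g i \<and> f i = S} = (\<lambda>i. (i, g i)) ` {i\<in>{..<M}. f i = S}" by auto
    then show ?thesis using fd[of S] that by (simp add: card_image inj_on_def)
  qed
  \<comment> \<open>Parts containing \<open>l\<close> are exactly the enlarged ones; a set avoiding
    \<open>l\<close> loses the copies that were enlarged, and Pascal's rule gives the new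
    count.\<close>
  have "card {(i, p). i < M \<and> p < m \<and> part c' (Suc l) i p = T} =
        (if card T \<le> k then (m * k - Suc l) choose (k - card T) else 0)" if T: "T \<subseteq> {..<Suc l}" for T
  proof (cases "l \<in> T")
    case True
    define S where "S = T - {l}"
    have S: "S \<subseteq> {..<l}" "T = insert l S" "l \<notin> S" using T True unfolding S_def by auto
    have cT: "card T = Suc (card S)" using S finite_subset[OF S(1)] by simp
    have "{(i, p). i < M \<and> p < m \<and> part c' (Suc l) i p = T} =
      {(i, p). i < M \<and> p = g i \<and> f i = S}"
      using g ins ins_eq S(2,3) unfolding part' by (auto split: if_splits)
    then show ?thesis using gcard[OF S(1)] unfolding cT d_def by (simp add: Suc_le_eq)
  next
    case False
    then have S: "T \<subseteq> {..<l}" using T by (auto simp: less_Suc_eq)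
    have "{(i, p). i < M \<and> p < m \<and> part c' (Suc l) i p = T} =
      {(i, p). i < M \<and> p < m \<and> part c l i p = T} - {(i, p). i < M \<and> p = g i \<and> f i = T}"
      using g notin False unfolding part' by (auto split: if_splits)
    moreover have "{(i, p). i < M \<and> p = g i \<and> f i = T} \<subseteq> {(i, p). i < M \<and> p < m \<and> part c l i p = T}"
      using g by auto
    ultimately have "card {(i, p). i < M \<and> p < m \<and> part c' (Suc l) i p = T} =
      (if card T \<le> k then (m * k - l) choose (k - card T) else 0) - d T"
      using cnt[OF S] gcard[OF S] fin by (simp add: card_Diff_subset finite_subset)
    also have "\<dots> = (if card T \<le> k then (m * k - Suc l) choose (k - card T) else 0)"
    proof (cases "card T < k")
      case True
      then obtain e where e: "k - card T = Suc e" "k - Suc (card T) = e"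
        by (metis Suc_diff_Suc)
      obtain r where r: "m * k - l = Suc r" "m * k - Suc l = r"
        using l by (metis Suc_diff_Suc)
      show ?thesis using True unfolding d_def e r by simp
    qed (auto simp: d_def)
    finally show ?thesis .
  qed
  moreover have "c' i x < m" if "i < M" "x < Suc l" for i x
    using that g st unfolding c'_def baranyai_stage_def by (auto simp: less_Suc_eq)
  ultimately have "baranyai_stage k m M (Suc l) c'"
    unfolding baranyai_stage_def by simp
  then show thesis by (rule that)
qed

text \<open>A colour class of \<open>col\<close> consists of pairwise disjoint sets; since there are only
  \<open>(n - 1) choose (k - 1)\<close> colours, each class is a partition of the ground set.\<close>

theorem baranyai:
  assumes k: "k > 0" and n: "n > 0" and "k dvd n"
  obtains col :: "nat set \<Rightarrow> nat"
  where "\<And>S. S \<subseteq> {..<n} \<Longrightarrow> card S = k \<Longrightarrow> col S < (n - 1) choose (k - 1)"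
    and "\<And>S T. S \<subseteq> {..<n} \<Longrightarrow> card S = k \<Longrightarrow> T \<subseteq> {..<n} \<Longrightarrow> card T = k \<Longrightarrow>
           col S = col T \<Longrightarrow> S \<inter> T \<noteq> {} \<Longrightarrow> S = T"
proof -
  obtain m where m: "n = m * k" using assms(3) by (metis dvd_def mult.commute)
  define M where "M = (n - 1) choose (k - 1)"
  have "\<exists>c. baranyai_stage k m M l c" if "l \<le> n" for l
    using that
  proof (induction l)
    case 0
    obtain e where e: "k = Suc e" using k by (cases k) auto
    \<comment> \<open>Initially all \<open>M * m\<close> parts are empty, and every
      \<open>k\<close>-subset has empty trace, so the required count is
      \<open>n choose k\<close>.\<close>
    have "k * (n choose k) = n * M"
      using binomial_absorption[of e n] unfolding M_def e by simp
    also have "n * M = k * (m * M)" unfolding m by (simp add: algebra_simps)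
    finally have "k * (n choose k) = k * (m * M)" .
    then have "M * m = n choose k" using k by simp
    moreover have "{(i, p). i < M \<and> p < m} = {..<M} \<times> {..<m}" by auto
    ultimately have "baranyai_stage k m M 0 (\<lambda>_ _. 0)"
      unfolding baranyai_stage_def part_def using m by simp
    then show ?case by blast
  next
    case (Suc l)
    then show ?case using baranyai_stage_Suc[of k m M l] m by (metis Suc_le_eq less_imp_le)
  qed
  then obtain c where c: "baranyai_stage k m M n c" by blast
  \<comment> \<open>No point remains to be distributed, so a \<open>k\<close>-set has the required
    count \<open>0 choose 0\<close>, which is \<open>1\<close>.\<close>
  have one: "card {(i, p). i < M \<and> p < m \<and> part c n i p = S} = 1" if "S \<subseteq> {..<n}" "card S = k" for S
    using c that m unfolding baranyai_stage_def by simp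
  have "\<exists>i p. i < M \<and> p < m \<and> part c n i p = S" if "S \<subseteq> {..<n}" "card S = k" for S
  proof -
    have "{(i, p). i < M \<and> p < m \<and> part c n i p = S} \<noteq> {}"
      using one[OF that] by (metis card.empty zero_neq_one)
    then show ?thesis by blast
  qed
  then obtain col p where
    col: "\<And>S. S \<subseteq> {..<n} \<Longrightarrow> card S = k \<Longrightarrow> col S < M \<and> p S < m \<and> part c n (col S) (p S) = S"
    by metis
  show thesis
  proof (rule that)
    fix S T assume S: "S \<subseteq> {..<n}" "card S = k" and T: "T \<subseteq> {..<n}" "card T = k"
      and eq: "col S = col T" and ne: "S \<inter> T \<noteq> {}"
    from ne obtain x where "x \<in> S" "x \<in> T" by blast
    then have "x \<in> part c n (col S) (p S)" "x \<in> part c n (col T) (p T)"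
      using col[OF S] col[OF T] by blast+
    then have "p S = p T" using eq unfolding part_def by simp
    then show "S = T" using col[OF S] col[OF T] eq by metis
  qed (use col M_def in auto)
qed

section \<open>Symmetric Latin cubes\<close>

text \<open>Codes \<open>4\<close> and \<open>5\<close> separate the two cyclic orders of distinct
  coordinates, which block symmetry does not identify.\<close>

definition kind :: "nat \<Rightarrow> nat \<Rightarrow> nat \<Rightarrow> nat" where
  "kind i j l = (if i = j \<and> j = l then 0 else if i = j then 1 else if i = l then 2
     else if j = l then 3
     else if i < j \<and> j < l \<or> j < l \<and> l < i \<or> l < i \<and> i < j then 4 else 5)"

lemma kind_rotate: "i \<noteq> j \<Longrightarrow> j \<noteq> l \<Longrightarrow> i \<noteq> l \<Longrightarrow> kind i j l = kind j l i"
  by (auto simp: kind_def)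

lemma kind_swap: "kind i i j = kind j j i" "kind i j i = kind j i j" "kind i j j = kind j i i"
  by (cases "i = j"; simp add: kind_def)+

lemma kind_transpose: "i \<noteq> j \<Longrightarrow> j \<noteq> l \<Longrightarrow> i \<noteq> l \<Longrightarrow> kind i j l \<noteq> kind i l j"
  by (cases i j rule: linorder_cases; cases j l rule: linorder_cases;
      cases i l rule: linorder_cases; simp add: kind_def)

lemma kind_eq_iff:
  "i = j \<longleftrightarrow> kind i j l \<in> {0, 1}" "i = l \<longleftrightarrow> kind i j l \<in> {0, 2}" "j = l \<longleftrightarrow> kind i j l \<in> {0, 3}"
  by (simp_all add: kind_def)

text \<open>The kind determines which coordinates coincide. The common set then leaves at most an
  exchange of \<open>j\<close> and \<open>l\<close> when all three are distinct, and that exchange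
  reverses the orientation.\<close>

lemma kind_inject_first:
  assumes k: "kind i j l = kind i j' l'" and S: "{i, j, l} = {i, j', l'}"
  shows "j = j' \<and> l = l'"
proof -
  have iff: "i = j \<longleftrightarrow> i = j'" "i = l \<longleftrightarrow> i = l'" "j = l \<longleftrightarrow> j' = l'"
    by (simp_all only: kind_eq_iff[where i = i and j = j and l = l]
      kind_eq_iff[where i = i and j = j' and l = l'] k)
  have mem: "j = i \<or> j = j' \<or> j = l'" "l = i \<or> l = j' \<or> l = l'"
    "j' = i \<or> j' = j \<or> j' = l" "l' = i \<or> l' = j \<or> l' = l"
    using S by (metis insert_iff empty_iff)+
  show ?thesis
  proof (cases "i \<noteq> j \<and> j \<noteq> l \<and> i \<noteq> l")
    case True
    then have "\<not> (j' = l \<and> l' = j)" using kind_transpose k by metis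
    then show ?thesis using True iff mem by metis
  next
    case False
    then show ?thesis using iff mem by metis
  qed
qed

text \<open>The kind after a rotation depends on the kind alone, so equality of kinds survives when
  a shared coordinate is rotated to the front.\<close>

lemma kind_rotation:
  "kind j l i = (if kind i j l \<in> {1, 2} then kind i j l + 1
     else if kind i j l = 3 then 1 else kind i j l)"
  by (cases "i = j"; cases "j = l"; cases "i = l"; simp add: kind_def)

lemma kind_inject:
  assumes k: "kind i j l = kind i' j' l'" and S: "{i, j, l} = {i', j', l'}"
    and "i = i' \<or> j = j' \<or> l = l'"
  shows "i = i' \<and> j = j' \<and> l = l'"
proof -
  have k2: "kind j l i = kind j' l' i'"
    by (simp only: kind_rotation[of j l i] kind_rotation[of j' l' i'] k)
  have k3: "kind l i j = kind l' i' j'"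
    by (simp only: kind_rotation[of l i j] kind_rotation[of l' i' j'] k2)
  have S2: "{j, l, i} = {j', l', i'}" and S3: "{l, i, j} = {l', i', j'}"
    using S by (metis insert_commute)+
  consider "i = i'" | "j = j'" | "l = l'" using assms(3) by blast
  then show ?thesis
  proof cases
    case 1
    then show ?thesis using kind_inject_first[of i j l j' l'] k S by simp
  next
    case 2
    then show ?thesis using kind_inject_first[of j l i l' i'] k2 S2 by simp
  next
    case 3
    then show ?thesis using kind_inject_first[of l i j i' j'] k3 S3 by simp
  qed
qed

section \<open>Colourings of singletons, pairs and triples\<close>

text \<open>One copy of the singletons, three of the pairs and two of the triples, labelled by kind.
  A point lies on \<open>1 + 3 * (v - 1) + 2 * ((v - 1) choose 2) = v^2\<close> of them, which is
  the number of colours aimed at.\<close>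

definition edge :: "nat \<Rightarrow> nat \<Rightarrow> nat set \<Rightarrow> bool" where
  "edge v a S \<longleftrightarrow> S \<subseteq> {..<v} \<and>
     (a = 0 \<and> card S = 1 \<or> a \<in> {1, 2, 3} \<and> card S = 2 \<or> a \<in> {4, 5} \<and> card S = 3)"

lemma edge_kind: "i < v \<Longrightarrow> j < v \<Longrightarrow> l < v \<Longrightarrow> edge v (kind i j l) {i, j, l}"
  unfolding edge_def kind_def by (auto simp: card_insert_if)

definition proper_colouring :: "nat \<Rightarrow> (nat \<Rightarrow> nat set \<Rightarrow> 'a) \<Rightarrow> bool" where
  "proper_colouring v Q \<longleftrightarrow>
     (\<forall>a S b T. edge v a S \<and> edge v b T \<and> Q a S = Q b T \<and> S \<inter> T \<noteq> {} \<longrightarrow> a = b \<and> S = T)"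

lemma proper_colouringD:
  "proper_colouring v Q \<Longrightarrow> edge v a S \<Longrightarrow> edge v b T \<Longrightarrow> Q a S = Q b T \<Longrightarrow>
    S \<inter> T \<noteq> {} \<Longrightarrow> a = b \<and> S = T"
  unfolding proper_colouring_def by blast

lemma two_choose_2: "2 * (n choose 2) = n * (n - 1)"
proof -
  have "even (n * (n - 1))" by (cases n) auto
  then show ?thesis unfolding choose_two by simp
qed

text \<open>Baranyai's theorem colours pairs with \<open>v - 1\<close> colours and triples with
  \<open>(v - 1) choose 2\<close>; singletons are disjoint and share one colour. Separate palettes
  for the six kinds use \<open>v^2\<close> colours altogether.\<close>

lemma colouring_0_mod_3:
  assumes "even v" "v > 0" "3 dvd v"
  obtains Q :: "nat \<Rightarrow> nat set \<Rightarrow> nat \<times> nat" and Y where "proper_colouring v Q"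
    and "\<And>a S. edge v a S \<Longrightarrow> Q a S \<in> Y" and "finite Y" and "card Y = v^2"
proof -
  obtain c2 where c2: "\<And>S. S \<subseteq> {..<v} \<Longrightarrow> card S = 2 \<Longrightarrow> c2 S < (v - 1) choose (2 - 1)"
    "\<And>S T. S \<subseteq> {..<v} \<Longrightarrow> card S = 2 \<Longrightarrow> T \<subseteq> {..<v} \<Longrightarrow> card T = 2 \<Longrightarrow>
           c2 S = c2 T \<Longrightarrow> S \<inter> T \<noteq> {} \<Longrightarrow> S = T"
    using baranyai[of 2 v] assms by auto
  obtain c3 where c3: "\<And>S. S \<subseteq> {..<v} \<Longrightarrow> card S = 3 \<Longrightarrow> c3 S < (v - 1) choose (3 - 1)"
    "\<And>S T. S \<subseteq> {..<v} \<Longrightarrow> card S = 3 \<Longrightarrow> T \<subseteq> {..<v} \<Longrightarrow> card T = 3 \<Longrightarrow>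
           c3 S = c3 T \<Longrightarrow> S \<inter> T \<noteq> {} \<Longrightarrow> S = T"
    using baranyai[of 3 v] assms by auto
  define Q where "Q a S = (a, if a = 0 then 0 else if a \<le> 3 then c2 S else c3 S)"
    for a :: nat and S
  define Y where "Y = {(0::nat, 0::nat)} \<union> {1, 2, 3} \<times> {..<v - 1} \<union> {4, 5} \<times> {..<(v - 1) choose 2}"
  have "proper_colouring v Q"
    unfolding proper_colouring_def
  proof (intro allI impI)
    fix a b S T assume A: "edge v a S \<and> edge v b T \<and> Q a S = Q b T \<and> S \<inter> T \<noteq> {}"
    then have ab: "a = b" unfolding Q_def by simp
    moreover have "S = T"
    proof (cases "a = 0")
      case True
      then show ?thesis using A unfolding ab edge_def by (auto simp: card_1_singleton_iff)
    next
      case False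
      then show ?thesis using A c2(2)[of S T] c3(2)[of S T] unfolding ab edge_def Q_def
        by (auto split: if_splits)
    qed
    ultimately show "a = b \<and> S = T" by simp
  qed
  moreover have "Q a S \<in> Y" if "edge v a S" for a S
    using that c2(1)[of S] c3(1)[of S] unfolding edge_def Q_def Y_def by auto
  moreover have "finite Y" unfolding Y_def by simp
  moreover have "card Y = v^2"
  proof -
    have "card Y = 1 + 3 * (v - 1) + 2 * ((v - 1) choose 2)"
      unfolding Y_def by (subst card_Un_disjoint; (subst card_Un_disjoint)?) auto
    moreover obtain u where "v = Suc (Suc u)" using assms(1,2) by (cases v; cases "v - 1") auto
    ultimately show ?thesis unfolding two_choose_2 by (simp add: power2_eq_square)
  qed
  ultimately show thesis by (rule that)
qed

text \<open>The triples of a one-point extension of the ground set are used: those through the new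
  point \<open>v\<close> colour two of the three kinds of pairs.\<close>

lemma colouring_2_mod_3:
  assumes "even v" "v > 0" "3 dvd Suc v"
  obtains Q :: "nat \<Rightarrow> nat set \<Rightarrow> nat \<times> nat" and Y where "proper_colouring v Q"
    and "\<And>a S. edge v a S \<Longrightarrow> Q a S \<in> Y" and "finite Y" and "card Y = v^2"
proof -
  obtain c2 where c2: "\<And>S. S \<subseteq> {..<v} \<Longrightarrow> card S = 2 \<Longrightarrow> c2 S < (v - 1) choose (2 - 1)"
    "\<And>S T. S \<subseteq> {..<v} \<Longrightarrow> card S = 2 \<Longrightarrow> T \<subseteq> {..<v} \<Longrightarrow> card T = 2 \<Longrightarrow>
           c2 S = c2 T \<Longrightarrow> S \<inter> T \<noteq> {} \<Longrightarrow> S = T"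
    using baranyai[of 2 v] assms by auto
  obtain c3 where c3: "\<And>S. S \<subseteq> {..<Suc v} \<Longrightarrow> card S = 3 \<Longrightarrow> c3 S < (Suc v - 1) choose (3 - 1)"
    "\<And>S T. S \<subseteq> {..<Suc v} \<Longrightarrow> card S = 3 \<Longrightarrow> T \<subseteq> {..<Suc v} \<Longrightarrow> card T = 3 \<Longrightarrow>
           c3 S = c3 T \<Longrightarrow> S \<inter> T \<noteq> {} \<Longrightarrow> S = T"
    using baranyai[of 3 "Suc v"] assms by auto
  define x where "x a S = (if a = 2 \<or> a = 3 then insert v S else S)" for a :: nat and S
  \<comment> \<open>Kinds \<open>2\<close> and \<open>4\<close> share one palette of
    \<open>v choose 2\<close> triple colours, kinds \<open>3\<close> and \<open>5\<close> another.
    With one colour for singletons and \<open>v - 1\<close> for kind \<open>1\<close> this makes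
    \<open>1 + (v - 1) + v * (v - 1) = v^2\<close>.\<close>
  define Q where "Q a S = (if a = 0 then (0 :: nat, 0) else if a = 1 then (1, c2 S)
      else (if a = 2 \<or> a = 4 then 4 else 5, c3 (x a S)))" for a :: nat and S
  define Y where "Y = {(0::nat, 0::nat)} \<union> {1} \<times> {..<v - 1} \<union> {4, 5} \<times> {..<v choose 2}"
  have x: "x a S \<subseteq> {..<Suc v} \<and> card (x a S) = 3 \<and> (v \<in> x a S \<longleftrightarrow> a = 2 \<or> a = 3) \<and> x a S - {v} = S"
    if "edge v a S" "a \<noteq> 0" "a \<noteq> 1" for a S
  proof -
    have S: "S \<subseteq> {..<v}" using that(1) unfolding edge_def by blast
    then have "finite S" "v \<notin> S" using finite_subset by auto
    then show ?thesis using S that unfolding edge_def x_def by (auto simp: less_Suc_eq)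
  qed
  have "proper_colouring v Q"
    unfolding proper_colouring_def
  proof (intro allI impI)
    fix a b S T assume A: "edge v a S \<and> edge v b T \<and> Q a S = Q b T \<and> S \<inter> T \<noteq> {}"
    consider "a = 0" "b = 0" | "a = 1" "b = 1" | "a \<noteq> 0" "a \<noteq> 1" "b \<noteq> 0" "b \<noteq> 1"
      using A unfolding Q_def by (auto split: if_splits)
    then show "a = b \<and> S = T"
    proof cases
      case 1
      then show ?thesis using A unfolding edge_def by (auto simp: card_1_singleton_iff)
    next
      case 2
      then show ?thesis using A c2(2)[of S T] unfolding edge_def Q_def by auto
    next
      case 3
      have "x a S \<inter> x b T \<noteq> {}" using A unfolding x_def by auto
      moreover have "c3 (x a S) = c3 (x b T)" using A 3 unfolding Q_def by auto
      ultimately have eq: "x a S = x b T"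
        using x[of a S] x[of b T] A 3 c3(2) by blast
      then have "S = T" using x[of a S] x[of b T] A 3 by metis
      \<comment> \<open>The new point tells kinds \<open>2\<close>, \<open>3\<close> from
        \<open>4\<close>, \<open>5\<close>, and the palette tells \<open>2\<close>, \<open>4\<close>
        from \<open>3\<close>, \<open>5\<close>; together they determine the kind.\<close>
      moreover have "(a = 2 \<or> a = 3) = (b = 2 \<or> b = 3)"
        using eq x[of a S] x[of b T] A 3 by metis
      moreover have "(a = 2 \<or> a = 4) = (b = 2 \<or> b = 4)"
        using A 3 unfolding Q_def by (auto split: if_splits)
      ultimately show ?thesis using A 3 unfolding edge_def by auto
    qed
  qed
  moreover have "Q a S \<in> Y" if "edge v a S" for a S
    using that c2(1)[of S] c3(1)[of "x a S"] x[of a S] unfolding edge_def Q_def Y_def by auto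
  moreover have "finite Y" unfolding Y_def by simp
  moreover have "card Y = v^2"
  proof -
    have "card Y = 1 + (v - 1) + 2 * (v choose 2)"
      unfolding Y_def by (subst card_Un_disjoint; (subst card_Un_disjoint)?) auto
    moreover obtain u where "v = Suc u" using assms(2) by (cases v) auto
    ultimately show ?thesis unfolding two_choose_2 by (simp add: power2_eq_square)
  qed
  ultimately show thesis by (rule that)
qed

section \<open>Latin cubes from colourings\<close>

text \<open>Symbols are distinct throughout each layer, not just along lines; with
  \<open>v^2\<close> symbols each one then occurs exactly once in every layer.\<close>

definition latin_cube :: "nat \<Rightarrow> (nat \<Rightarrow> nat \<Rightarrow> nat \<Rightarrow> nat) \<Rightarrow> bool" where
  "latin_cube v s \<longleftrightarrow>
     (\<forall>i<v. \<forall>j<v. \<forall>l<v. s i j l < v^2) \<and>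
     (\<forall>i<v. \<forall>j<v. \<forall>l<v. \<forall>i'<v. \<forall>j'<v. \<forall>l'<v.
        s i j l = s i' j' l' \<longrightarrow> i = i' \<or> j = j' \<or> l = l' \<longrightarrow> i = i' \<and> j = j' \<and> l = l')"

lemma symmetric_latin_cube:
  assumes "even v" "v > 0" "v mod 3 = 0 \<or> v mod 3 = 2"
  obtains s where "latin_cube v s"
    and "\<And>i j l. i \<noteq> j \<Longrightarrow> j \<noteq> l \<Longrightarrow> i \<noteq> l \<Longrightarrow> s i j l = s j l i"
    and "\<And>i j. s i i j = s j j i" "\<And>i j. s i j i = s j i j" "\<And>i j. s i j j = s j i i"
proof -
  have "\<exists>(Q :: nat \<Rightarrow> nat set \<Rightarrow> nat \<times> nat) Y. proper_colouring v Q \<and>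
    (\<forall>a S. edge v a S \<longrightarrow> Q a S \<in> Y) \<and> finite Y \<and> card Y = v^2"
  proof (cases "v mod 3 = 0")
    case True
    then show ?thesis using colouring_0_mod_3[of v] assms by (metis mod_0_imp_dvd)
  next
    case False
    then have "3 dvd Suc v" using assms(3) by presburger
    then show ?thesis using colouring_2_mod_3[of v] assms by metis
  qed
  then obtain Q :: "nat \<Rightarrow> nat set \<Rightarrow> nat \<times> nat" and Y where
    Q: "proper_colouring v Q" "\<And>a S. edge v a S \<Longrightarrow> Q a S \<in> Y" and Y: "finite Y" "card Y = v^2"
    by blast
  obtain e where e: "bij_betw e Y {0..<v^2}"
    using ex_bij_betw_finite_nat[OF Y(1)] Y(2) by auto
  define s where "s i j l = e (Q (kind i j l) {i, j, l})" for i j l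
  have "latin_cube v s"
    unfolding latin_cube_def
  proof (intro conjI allI impI)
    fix i j l assume "i < v" "j < v" "l < v"
    then show "s i j l < v^2"
      using bij_betwE[OF e] Q(2)[OF edge_kind[of i v j l]] unfolding s_def by auto
  next
    fix i j l i' j' l'
    assume lt: "i < v" "j < v" "l < v" "i' < v" "j' < v" "l' < v"
      and eq: "s i j l = s i' j' l'" and co: "i = i' \<or> j = j' \<or> l = l'"
    have "Q (kind i j l) {i, j, l} = Q (kind i' j' l') {i', j', l'}"
      using inj_onD[OF bij_betw_imp_inj_on[OF e] eq[unfolded s_def]]
        Q(2)[OF edge_kind[OF lt(1-3)]] Q(2)[OF edge_kind[OF lt(4-6)]] by simp
    moreover have "{i, j, l} \<inter> {i', j', l'} \<noteq> {}" using co by auto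
    ultimately have "kind i j l = kind i' j' l' \<and> {i, j, l} = {i', j', l'}"
      using proper_colouringD[OF Q(1) edge_kind[OF lt(1-3)] edge_kind[OF lt(4-6)]] by simp
    then have "i = i' \<and> j = j' \<and> l = l'" using kind_inject[of i j l i' j' l'] co by simp
    then show "i = i'" "j = j'" "l = l'" by auto
  qed
  moreover have "s i j l = s j l i" if "i \<noteq> j" "j \<noteq> l" "i \<noteq> l" for i j l
    unfolding s_def kind_rotate[OF that] by (simp add: insert_commute)
  moreover have "s i i j = s j j i" "s i j i = s j i j" "s i j j = s j i i" for i j
    unfolding s_def using kind_swap[of i j]
    by (metis insert_absorb2 insert_commute)+
  ultimately show thesis by (rule that)
qed

section \<open>Sign arrays from Hadamard matrices\<close>

definition orthogonal_signs :: "nat \<Rightarrow> (nat \<Rightarrow> nat \<Rightarrow> int) \<Rightarrow> bool" where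
  "orthogonal_signs n h \<longleftrightarrow>
     (\<forall>s<n. \<forall>a<n. h s a \<in> {1, -1}) \<and>
     (\<forall>s<n. \<forall>s'<n. s \<noteq> s' \<longrightarrow> (\<Sum>a<n. h s a * h s' a) = 0) \<and>
     (\<forall>a<n. \<forall>a'<n. a \<noteq> a' \<longrightarrow> (\<Sum>s<n. h s a * h s a') = 0)"

lemma hadamard_matrix_orthogonal_signs:
  assumes "hadamard_matrix n H"
  shows "orthogonal_signs n (\<lambda>s a. H $$ (s, a))"
proof -
  have H: "dim_row H = n" "dim_col H = n" using assms unfolding hadamard_matrix_def by auto
  have "H $$ (s, a) \<in> {1, -1}" if "s < n" "a < n" for s a
    using assms elements_matI[OF _ that refl, of H] unfolding hadamard_matrix_def by blast
  moreover have "(\<Sum>a<n. H $$ (s, a) * H $$ (s', a)) = 0" if "s < n" "s' < n" "s \<noteq> s'" for s s'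
  proof -
    have "row H s \<bullet> row H s' = 0" using assms that unfolding hadamard_matrix_def by blast
    then show ?thesis using that H by (simp add: scalar_prod_def atLeast0LessThan)
  qed
  moreover have "(\<Sum>s<n. H $$ (s, a) * H $$ (s, a')) = 0" if "a < n" "a' < n" "a \<noteq> a'" for a a'
  proof -
    have "col H a \<bullet> col H a' = 0" using assms that unfolding hadamard_matrix_def by blast
    then show ?thesis using that H by (simp add: scalar_prod_def atLeast0LessThan)
  qed
  ultimately show ?thesis unfolding orthogonal_signs_def by blast
qed

text \<open>Row products are unchanged because \<open>r a * r a = 1\<close>, and column products are
  only multiplied by a sign. This serves both to normalise one row and to negate the whole
  matrix.\<close>

lemma orthogonal_signs_scale_cols:
  assumes "orthogonal_signs n h" and r: "\<And>a. a < n \<Longrightarrow> r a \<in> {1, -1}"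
  shows "orthogonal_signs n (\<lambda>s a. r a * h s a)"
proof -
  have rr: "r a * r a = 1" if "a < n" for a using r[OF that] by auto
  have "(\<Sum>a<n. r a * h s a * (r a * h s' a)) = (\<Sum>a<n. h s a * h s' a)" for s s'
  proof (intro sum.cong refl)
    fix a assume "a \<in> {..<n}"
    then have "r a * r a = 1" using rr by simp
    moreover have "r a * h s a * (r a * h s' a) = (r a * r a) * (h s a * h s' a)"
      by (simp add: mult_ac)
    ultimately show "r a * h s a * (r a * h s' a) = h s a * h s' a" by simp
  qed
  moreover have "(\<Sum>s<n. r a * h s a * (r a' * h s a')) = r a * r a' * (\<Sum>s<n. h s a * h s a')" for a a'
    by (simp add: sum_distrib_left mult_ac)
  moreover have "r a * h s a \<in> {1, -1}" if "s < n" "a < n" for s a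
    using r[of a] assms(1) that unfolding orthogonal_signs_def by fastforce
  ultimately show ?thesis using assms(1) unfolding orthogonal_signs_def by simp
qed

lemma orthogonal_signs_row_norm:
  assumes "orthogonal_signs n h" "s < n"
  shows "(\<Sum>a<n. h s a * h s a) = int n"
proof -
  have "(\<Sum>a<n. h s a * h s a) = (\<Sum>a<n. 1)"
    using assms unfolding orthogonal_signs_def by (intro sum.cong refl) fastforce
  then show ?thesis by simp
qed

text \<open>A product of two signs is odd, so a sum of \<open>n\<close> of them has the parity of
  \<open>n\<close>; for two orthogonal rows it is zero.\<close>

lemma orthogonal_signs_even:
  assumes "orthogonal_signs n h" "n > 1"
  shows "even n"
proof -
  have "(\<Sum>a<n. h 0 a * h 1 a) = 0" using assms unfolding orthogonal_signs_def by simp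
  moreover have "even ((\<Sum>a<n. h 0 a * h 1 a) - (\<Sum>a<n. 1))"
    unfolding sum_subtractf[symmetric]
  proof (intro dvd_sum)
    fix a assume "a \<in> {..<n}"
    then have "h 0 a \<in> {1, -1}" "h 1 a \<in> {1, -1}"
      using assms unfolding orthogonal_signs_def by auto
    then show "even (h 0 a * h 1 a - 1)" by auto
  qed
  ultimately show ?thesis by simp
qed

section \<open>From sign arrays to 0/1 cubes\<close>

text \<open>\<open>layer\<close> is tied to natural-number entries; working with positions lets
  integer arrays be sliced in the same way.\<close>

definition pick :: "nat \<Rightarrow> nat \<Rightarrow> nat \<times> nat \<Rightarrow> nat \<times> nat \<times> nat" where
  "pick d c = (\<lambda>(a, b). if d = 1 then (c, a, b) else if d = 2 then (a, c, b) else (a, b, c))"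

lemma layer_eq_pick: "layer A d c p = A (pick d c p)"
  unfolding layer_def pick_def by (simp split: prod.split)

text \<open>With \<open>2 * A = 1 + B\<close>, a layer with sign sum \<open>- t\<close> has
  \<open>(w^2 - t) / 2\<close> ones, and expanding \<open>(1 + B) * (1 + B')\<close> for orthogonal
  layers \<open>B\<close>, \<open>B'\<close> gives the scalar product
  \<open>(w^2 - 2 * t) / 4\<close>.\<close>

lemma C33_of_signs:
  fixes B :: "nat \<times> nat \<times> nat \<Rightarrow> int"
  assumes B: "\<And>q. q \<in> positions w \<Longrightarrow> B q \<in> {1, -1}"
    and total: "\<And>d c. d \<in> {1, 2, 3} \<Longrightarrow> c \<in> {1..w} \<Longrightarrow>
      (\<Sum>p\<in>{1..w} \<times> {1..w}. B (pick d c p)) = - t"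
    and orth: "\<And>d c c'. d \<in> {1, 2, 3} \<Longrightarrow> c \<in> {1..w} \<Longrightarrow> c' \<in> {1..w} \<Longrightarrow> c \<noteq> c' \<Longrightarrow>
      (\<Sum>p\<in>{1..w} \<times> {1..w}. B (pick d c p) * B (pick d c' p)) = 0"
    and k: "2 * int k = int w ^ 2 - t" and l: "4 * int l = int w ^ 2 - 2 * t"
  shows "(\<lambda>q\<in>positions w. if B q = 1 then 1 else 0) \<in> C33 w k l"
proof -
  define A where "A = (\<lambda>q\<in>positions w. if B q = 1 then 1 else 0 :: nat)"
  let ?W = "{1..w} \<times> {1..w}"
  have pos: "pick d c p \<in> positions w" if "c \<in> {1..w}" "p \<in> ?W" for d c p
    using that unfolding pick_def positions_def by auto
  have A2: "2 * int (A q) = 1 + B q" if "q \<in> positions w" for q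
    using B[OF that] that unfolding A_def by auto
  have "card {p \<in> ?W. layer A d c p = 1} = k" if d: "d \<in> {1, 2, 3}" and c: "c \<in> {1..w}" for d c
  proof -
    have "int (card {p \<in> ?W. layer A d c p = 1}) = (\<Sum>p\<in>?W. if layer A d c p = 1 then 1 else 0)"
      by (simp add: sum.If_cases Int_def)
    also have "\<dots> = (\<Sum>p\<in>?W. int (layer A d c p))"
      using pos[OF c] unfolding layer_eq_pick by (intro sum.cong refl) (auto simp: A_def)
    finally have "2 * int (card {p \<in> ?W. layer A d c p = 1}) = (\<Sum>p\<in>?W. 2 * int (layer A d c p))"
      by (simp add: sum_distrib_left)
    also have "\<dots> = (\<Sum>p\<in>?W. 1 + B (pick d c p))"
      using A2 pos[OF c] unfolding layer_eq_pick by (intro sum.cong refl) blast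
    also have "\<dots> = int w ^ 2 - t"
      using total[OF d c] by (simp add: sum.distrib power2_eq_square)
    finally show ?thesis using k by simp
  qed
  moreover have "(\<Sum>p\<in>?W. layer A d c p * layer A d c' p) = l"
    if d: "d \<in> {1, 2, 3}" and c: "c \<in> {1..w}" "c' \<in> {1..w}" "c \<noteq> c'" for d c c'
  proof -
    have "4 * int (\<Sum>p\<in>?W. layer A d c p * layer A d c' p) =
        (\<Sum>p\<in>?W. (2 * int (layer A d c p)) * (2 * int (layer A d c' p)))"
      by (simp add: sum_distrib_left mult_ac)
    also have "\<dots> = (\<Sum>p\<in>?W. (1 + B (pick d c p)) * (1 + B (pick d c' p)))"
      using A2 pos c unfolding layer_eq_pick by (intro sum.cong refl) metis
    also have "\<dots> = (\<Sum>p\<in>?W. 1 + B (pick d c p) + B (pick d c' p) + B (pick d c p) * B (pick d c' p))"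
      by (simp add: algebra_simps)
    also have "\<dots> = int w ^ 2 - 2 * t"
      using total[OF d c(1)] total[OF d c(2)] orth[OF d c] by (simp add: sum.distrib power2_eq_square)
    finally have "4 * int (\<Sum>p\<in>?W. layer A d c p * layer A d c' p) = 4 * int l" unfolding l .
    then show ?thesis by linarith
  qed
  moreover have "A \<in> positions w \<rightarrow>\<^sub>E {0, 1}" unfolding A_def by auto
  ultimately show ?thesis unfolding C33_def A_def[symmetric] by blast
qed

text \<open>A coordinate starts at \<open>1\<close>, while its block index and inner index both
  start at \<open>0\<close>; hence the shift \<open>x - 1\<close> before division.\<close>

lemma sum_div_mod:
  fixes f :: "nat \<Rightarrow> nat \<Rightarrow> 'a::comm_monoid_add"
  assumes "n > 0"
  shows "(\<Sum>x\<in>{1..v * n}. f ((x - 1) div n) ((x - 1) mod n)) = (\<Sum>i<v. \<Sum>a<n. f i a)"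
proof -
  have "(\<Sum>x\<in>{1..v * n}. f ((x - 1) div n) ((x - 1) mod n)) = (\<Sum>(i, a)\<in>{..<v} \<times> {..<n}. f i a)"
  proof (rule sum.reindex_bij_witness)
    fix x assume "x \<in> {1..v * n}"
    then have "x - 1 < v * n" "x > 0" by auto
    then show "((\<lambda>(i, a). n * i + a + 1) ((x - 1) div n, (x - 1) mod n)) = x"
      "((x - 1) div n, (x - 1) mod n) \<in> {..<v} \<times> {..<n}"
      using assms by (auto simp: less_mult_imp_div_less)
  next
    fix p assume "p \<in> {..<v} \<times> {..<n}"
    then obtain i a where p: "p = (i, a)" "i < v" "a < n" by auto
    have "n * i + a < n * Suc i" using p by simp
    also have "\<dots> \<le> n * v" using p by (intro mult_le_mono2) simp
    finally show "(\<lambda>(i, a). n * i + a + 1) p \<in> {1..v * n}" using p by (simp add: mult.commute)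
    show "(((\<lambda>(i, a). n * i + a + 1) p - 1) div n, ((\<lambda>(i, a). n * i + a + 1) p - 1) mod n) = p"
      using p by simp
  qed auto
  then show ?thesis by (simp add: sum.cartesian_product)
qed

text \<open>For fixed blocks the two inner coordinates separate into equal factors. Layer sums and
  scalar products of two layers both have this form, with \<open>g\<close> a row or a product of two
  rows.\<close>

lemma sum_div_mod_square:
  fixes f g :: "nat \<Rightarrow> nat \<Rightarrow> nat \<Rightarrow> int"
  assumes "n > 0"
  shows "(\<Sum>(y, z)\<in>{1..v * n} \<times> {1..v * n}.
      u ((y - 1) div n) ((z - 1) div n) *
      (g ((y - 1) div n) ((z - 1) div n) ((y - 1) mod n) * g ((y - 1) div n) ((z - 1) div n) ((z - 1) mod n))) =
    (\<Sum>j<v. \<Sum>l<v. u j l * (\<Sum>b<n. g j l b)^2)"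
proof -
  have "(\<Sum>(y, z)\<in>{1..v * n} \<times> {1..v * n}.
      u ((y - 1) div n) ((z - 1) div n) *
      (g ((y - 1) div n) ((z - 1) div n) ((y - 1) mod n) * g ((y - 1) div n) ((z - 1) div n) ((z - 1) mod n))) =
    (\<Sum>j<v. \<Sum>b<n. \<Sum>l<v. \<Sum>c<n. u j l * (g j l b * g j l c))"
    unfolding sum.cartesian_product[symmetric]
    by (subst sum_div_mod[OF assms,
          where f = "\<lambda>j b. \<Sum>z = 1..v * n. u j ((z - 1) div n) *
            (g j ((z - 1) div n) b * g j ((z - 1) div n) ((z - 1) mod n))"])
       (intro sum.cong refl sum_div_mod[OF assms])
  also have "\<dots> = (\<Sum>j<v. \<Sum>l<v. \<Sum>b<n. \<Sum>c<n. u j l * (g j l b * g j l c))"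
    by (intro sum.cong refl sum.swap)
  also have "\<dots> = (\<Sum>j<v. \<Sum>l<v. u j l * (\<Sum>b<n. g j l b)^2)"
    by (intro sum.cong refl) (simp only: power2_eq_square sum_product, simp only: sum_distrib_left)
  finally show ?thesis .
qed

section \<open>Sign cubes with rank-one blocks\<close>

definition sign_cube :: "nat \<Rightarrow> (nat \<Rightarrow> nat \<Rightarrow> int) \<Rightarrow> (nat \<Rightarrow> nat \<Rightarrow> nat \<Rightarrow> nat) \<Rightarrow> nat \<times> nat \<times> nat \<Rightarrow> int" where
  "sign_cube n h s = (\<lambda>(x, y, z).
     let e = s ((x - 1) div n) ((y - 1) div n) ((z - 1) div n)
     in h e ((x - 1) mod n) * h e ((y - 1) mod n) * h e ((z - 1) mod n))"

text \<open>Puts the coordinate fixed in direction \<open>d\<close> first, so that only layers in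
  direction \<open>1\<close> need computing.\<close>

definition direction_perm :: "nat \<Rightarrow> (nat \<Rightarrow> nat \<Rightarrow> nat \<Rightarrow> 'a) \<Rightarrow> nat \<Rightarrow> nat \<Rightarrow> nat \<Rightarrow> 'a" where
  "direction_perm d s i j l = (if d = 1 then s i j l else if d = 2 then s j i l else s j l i)"

lemma latin_cube_less: "latin_cube v s \<Longrightarrow> i < v \<Longrightarrow> j < v \<Longrightarrow> l < v \<Longrightarrow> s i j l < v^2"
  unfolding latin_cube_def by blast

lemma latin_cube_inject:
  assumes "latin_cube v s" "i < v" "j < v" "l < v" "i' < v" "j' < v" "l' < v"
    and "s i j l = s i' j' l'" "i = i' \<or> j = j' \<or> l = l'"
  shows "i = i' \<and> j = j' \<and> l = l'"
  using assms(1)[unfolded latin_cube_def, THEN conjunct2, rule_format, OF assms(2-9)] by simp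

lemma latin_cube_direction_perm:
  assumes "latin_cube v s"
  shows "latin_cube v (direction_perm d s)"
  unfolding latin_cube_def
proof (intro conjI allI impI)
  fix i j l assume "i < v" "j < v" "l < v"
  then show "direction_perm d s i j l < v^2"
    unfolding direction_perm_def using latin_cube_less[OF assms] by simp
next
  fix i j l i' j' l'
  assume lt: "i < v" "j < v" "l < v" "i' < v" "j' < v" "l' < v"
    and eq: "direction_perm d s i j l = direction_perm d s i' j' l'"
    and co: "i = i' \<or> j = j' \<or> l = l'"
  consider "d = 1" | "d = 2" | "d \<noteq> 1" "d \<noteq> 2" by blast
  then have "i = i' \<and> j = j' \<and> l = l'"
  proof cases
    case 1
    then have "s i j l = s i' j' l'" using eq by (simp add: direction_perm_def)
    from latin_cube_inject[OF assms lt this co] show ?thesis .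
  next
    case 2
    then have "s j i l = s j' i' l'" using eq by (simp add: direction_perm_def)
    from latin_cube_inject[OF assms lt(2,1,3,5,4,6) this] show ?thesis using co by argo
  next
    case 3
    then have "s j l i = s j' l' i'" using eq by (simp add: direction_perm_def)
    from latin_cube_inject[OF assms lt(2,3,1,5,6,4) this] show ?thesis using co by argo
  qed
  then show "i = i'" "j = j'" "l = l'" by auto
qed

text \<open>The same row \<open>h e\<close> enters in all three coordinates, so permuting
  coordinates only permutes the arguments of \<open>s\<close>.\<close>

lemma sign_cube_pick:
  "sign_cube n h s (pick d x p) = sign_cube n h (direction_perm d s) (pick 1 x p)"
  unfolding sign_cube_def pick_def direction_perm_def by (simp add: Let_def mult_ac split: prod.split)

lemma latin_cube_layer_bij:
  assumes "latin_cube v s" "i < v"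
  shows "bij_betw (\<lambda>(j, l). s i j l) ({..<v} \<times> {..<v}) {..<v^2}"
proof -
  have "inj_on (\<lambda>(j, l). s i j l) ({..<v} \<times> {..<v})"
    using latin_cube_inject[OF assms(1,2) _ _ assms(2)] unfolding inj_on_def by auto
  moreover have "(\<lambda>(j, l). s i j l) ` ({..<v} \<times> {..<v}) = {..<v^2}"
    using latin_cube_less[OF assms] calculation
    by (intro card_subset_eq) (auto simp: card_image power2_eq_square)
  ultimately show ?thesis unfolding bij_betw_def by blast
qed

lemma latin_cube_sum:
  assumes "latin_cube v s" "i < v"
  shows "(\<Sum>j<v. \<Sum>l<v. u (s i j l)) = (\<Sum>e<v^2. u e)"
  using sum.reindex_bij_betw[OF latin_cube_layer_bij[OF assms], of u]
  by (simp add: sum.cartesian_product split_def)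

lemma sign_cube_sum:
  assumes "latin_cube v s" "n = v^2" "n > 0" "x \<in> {1..v * n}"
  shows "(\<Sum>p\<in>{1..v * n} \<times> {1..v * n}. sign_cube n h s (pick 1 x p)) =
    (\<Sum>e<n. h e ((x - 1) mod n) * (\<Sum>b<n. h e b)^2)"
proof -
  define i a where "i = (x - 1) div n" and "a = (x - 1) mod n"
  have i: "i < v" using assms(4) unfolding i_def by (intro less_mult_imp_div_less) auto
  have "(\<Sum>p\<in>{1..v * n} \<times> {1..v * n}. sign_cube n h s (pick 1 x p)) =
    (\<Sum>j<v. \<Sum>l<v. h (s i j l) a * (\<Sum>b<n. h (s i j l) b)^2)"
    unfolding sum_div_mod_square[OF assms(3), where g = "\<lambda>j l. h (s i j l)", symmetric]
    by (intro sum.cong refl)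
      (auto simp: sign_cube_def pick_def i_def a_def Let_def mult_ac)
  also have "\<dots> = (\<Sum>e<n. h e a * (\<Sum>b<n. h e b)^2)"
    unfolding assms(2) by (rule latin_cube_sum[OF assms(1) i])
  finally show ?thesis unfolding a_def .
qed

lemma sign_cube_orthogonal:
  assumes s: "latin_cube v s" and n: "n = v^2" "n > 0" and h: "orthogonal_signs n h"
    and x: "x \<in> {1..v * n}" "x' \<in> {1..v * n}" "x \<noteq> x'"
  shows "(\<Sum>p\<in>{1..v * n} \<times> {1..v * n}.
    sign_cube n h s (pick 1 x p) * sign_cube n h s (pick 1 x' p)) = 0"
proof -
  define i a where "i = (x - 1) div n" and "a = (x - 1) mod n"
  define i' a' where "i' = (x' - 1) div n" and "a' = (x' - 1) mod n"
  have i: "i < v" "i' < v" using x unfolding i_def i'_def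
    by (intro less_mult_imp_div_less; auto)+
  have a: "a < n" "a' < n" using n unfolding a_def a'_def by auto
  have "(\<Sum>p\<in>{1..v * n} \<times> {1..v * n}.
      sign_cube n h s (pick 1 x p) * sign_cube n h s (pick 1 x' p)) =
    (\<Sum>j<v. \<Sum>l<v. h (s i j l) a * h (s i' j l) a' * (\<Sum>b<n. h (s i j l) b * h (s i' j l) b)^2)"
    unfolding sum_div_mod_square[OF n(2), where g = "\<lambda>j l b. h (s i j l) b * h (s i' j l) b", symmetric]
    by (intro sum.cong refl)
      (auto simp: sign_cube_def pick_def i_def a_def i'_def a'_def Let_def mult_ac)
  also have "\<dots> = 0"
  proof (cases "i = i'")
    case True
    have "x - 1 \<noteq> x' - 1" using x by auto
    then have "a \<noteq> a'" using True unfolding i_def i'_def a_def a'_def by (metis div_mult_mod_eq)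
    then have 0: "(\<Sum>e<n. h e a * h e a') = 0" using h a unfolding orthogonal_signs_def by blast
    \<comment> \<open>Both layers meet the same symbols, so the squared factor is the constant
      \<open>n^2\<close> and column orthogonality applies.\<close>
    have "(\<Sum>j<v. \<Sum>l<v. h (s i j l) a * h (s i' j l) a' * (\<Sum>b<n. h (s i j l) b * h (s i' j l) b)^2) =
      (\<Sum>e<n. h e a * h e a' * (\<Sum>b<n. h e b * h e b)^2)"
      unfolding True[symmetric] n(1)
      by (rule latin_cube_sum[OF s i(1), where u = "\<lambda>e. h e a * h e a' * (\<Sum>b<v^2. h e b * h e b)^2"])
    also have "\<dots> = (\<Sum>e<n. h e a * h e a' * int n ^ 2)"
      using orthogonal_signs_row_norm[OF h] by (intro sum.cong refl) auto
    finally show ?thesis using 0 by (simp add: sum_distrib_right[symmetric])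
  next
    case False
    \<comment> \<open>Opposite cells in different blocks carry distinct symbols, so row
      orthogonality annihilates every squared factor.\<close>
    have "(\<Sum>b<n. h (s i j l) b * h (s i' j l) b) = 0" if "j < v" "l < v" for j l
    proof -
      have "s i j l \<noteq> s i' j l" using latin_cube_inject[OF s i(1) that i(2) that] False by auto
      moreover have "s i j l < n" "s i' j l < n" using latin_cube_less[OF s] i that n by auto
      ultimately show ?thesis using h unfolding orthogonal_signs_def by blast
    qed
    then show ?thesis by simp
  qed
  finally show ?thesis .
qed

lemma sign_cube_C33:
  assumes s: "latin_cube v s" and v: "v > 0" and h: "orthogonal_signs (v^2) h"
    and t: "\<And>a. a < v^2 \<Longrightarrow> (\<Sum>e<v^2. h e a * (\<Sum>b<v^2. h e b)^2) = - t"
    and k: "2 * int k = int v ^ 6 - t" and l: "4 * int l = int v ^ 6 - 2 * t"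
  shows "(\<lambda>q\<in>positions (v^3). if sign_cube (v^2) h s q = 1 then 1 else 0) \<in> C33 (v^3) k l"
proof (rule C33_of_signs)
  have v3: "v^3 = v * v^2" by (simp add: power3_eq_cube power2_eq_square)
  have n: "v^2 > 0" using v by simp
  note sd = latin_cube_direction_perm[OF s]
  show "sign_cube (v^2) h s q \<in> {1, -1}" if q: "q \<in> positions (v^3)" for q
  proof -
    obtain x y z where xyz: "q = (x, y, z)" "x \<in> {1..v^3}" "y \<in> {1..v^3}" "z \<in> {1..v^3}"
      using q unfolding positions_def by auto
    have "(x - 1) div v^2 < v" if "x \<in> {1..v^3}" for x
      using that unfolding v3 by (intro less_mult_imp_div_less) auto
    then have "s ((x - 1) div v^2) ((y - 1) div v^2) ((z - 1) div v^2) < v^2"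
      using xyz latin_cube_less[OF s] by blast
    then have "h (s ((x - 1) div v^2) ((y - 1) div v^2) ((z - 1) div v^2)) (c mod v^2) \<in> {1, -1}" for c
      using h n unfolding orthogonal_signs_def by simp
    moreover have "p * q * r \<in> {1, -1}"
      if "p \<in> {1, -1}" "q \<in> {1, -1}" "r \<in> {1, -1}" for p q r :: int
      using that by auto
    ultimately show ?thesis unfolding xyz(1) sign_cube_def Let_def prod.case by blast
  qed
  show "(\<Sum>p\<in>{1..v^3} \<times> {1..v^3}. sign_cube (v^2) h s (pick d c p)) = - t"
    if "c \<in> {1..v^3}" for d c
  proof -
    have "(c - 1) mod v^2 < v^2" using n by simp
    then show ?thesis unfolding sign_cube_pick[of _ _ _ d]
      using sign_cube_sum[OF sd refl n] t that unfolding v3 by simp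
  qed
  show "(\<Sum>p\<in>{1..v^3} \<times> {1..v^3}.
      sign_cube (v^2) h s (pick d c p) * sign_cube (v^2) h s (pick d c' p)) = 0"
    if "c \<in> {1..v^3}" "c' \<in> {1..v^3}" "c \<noteq> c'" for d c c'
    unfolding sign_cube_pick[of _ _ _ d] v3
    using that unfolding v3 by (intro sign_cube_orthogonal[OF sd refl n h])
  show "2 * int k = int (v^3)^2 - t" "4 * int l = int (v^3)^2 - 2 * t"
    using k l by (simp_all add: power_mult[symmetric])
qed

section \<open>Block symmetry\<close>

lemma block_sign_cube:
  assumes "i \<in> {1..v}" "j \<in> {1..v}" "l \<in> {1..v}"
  shows "block v (\<lambda>q\<in>positions (v^3). if sign_cube (v^2) h s q = 1 then 1 else 0) i j l =
    (\<lambda>(a, b, c)\<in>positions (v^2). let e = s (i - 1) (j - 1) (l - 1) in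
       if h e (a - 1) * h e (b - 1) * h e (c - 1) = 1 then 1 else 0)"
  unfolding block_def
proof (rule restrict_ext)
  fix q assume "q \<in> positions (v^2)"
  then obtain a b c where q: "q = (a, b, c)" "a \<in> {1..v^2}" "b \<in> {1..v^2}" "c \<in> {1..v^2}"
    unfolding positions_def by auto
  have pos: "v^2 * (i - 1) + a \<in> {1..v^3}" if "i \<in> {1..v}" "a \<in> {1..v^2}" for i a
  proof -
    have "v^2 * (i - 1) + a \<le> v^2 * (i - 1) + v^2" using that by simp
    also have "\<dots> = v^2 * i" using that by (cases i) auto
    also have "\<dots> \<le> v^2 * v" using that by (intro mult_le_mono2) simp
    finally show ?thesis using that by (simp add: power3_eq_cube power2_eq_square)
  qed
  have dm: "(v^2 * (i - 1) + a - 1) div v^2 = i - 1 \<and> (v^2 * (i - 1) + a - 1) mod v^2 = a - 1"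
    if "a \<in> {1..v^2}" for i a
  proof -
    have "v^2 * (i - 1) + a - 1 = v^2 * (i - 1) + (a - 1)" "a - 1 < v^2" "v \<noteq> 0"
      using that assms by auto
    then show ?thesis by simp
  qed
  show "(case q of (a, b, c) \<Rightarrow>
      (\<lambda>q\<in>positions (v^3). if sign_cube (v^2) h s q = 1 then 1 else 0)
        (v^2 * (i - 1) + a, v^2 * (j - 1) + b, v^2 * (l - 1) + c)) =
    (case q of (a, b, c) \<Rightarrow> let e = s (i - 1) (j - 1) (l - 1) in
       if h e (a - 1) * h e (b - 1) * h e (c - 1) = 1 then 1 else 0)"
    using pos assms q dm by (simp add: positions_def sign_cube_def Let_def)
qed

lemma sign_cube_block_symmetric:
  assumes "\<And>i j l. i \<noteq> j \<Longrightarrow> j \<noteq> l \<Longrightarrow> i \<noteq> l \<Longrightarrow> s i j l = s j l i"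
    and "\<And>i j. s i i j = s j j i" "\<And>i j. s i j i = s j i j" "\<And>i j. s i j j = s j i i"
  shows "block_symmetric v (\<lambda>q\<in>positions (v^3). if sign_cube (v^2) h s q = 1 then 1 else 0)"
proof -
  have rot: "s (i - 1) (j - 1) (l - 1) = s (j - 1) (l - 1) (i - 1)"
    if "i \<in> {1..v}" "j \<in> {1..v}" "l \<in> {1..v}" "i \<noteq> j" "j \<noteq> l" "i \<noteq> l" for i j l
    using that by (intro assms(1)) auto
  show ?thesis
    unfolding block_symmetric_def
  proof (intro conjI ballI impI)
    fix i j l assume r: "i \<in> {1..v}" "j \<in> {1..v}" "l \<in> {1..v}" and d: "i \<noteq> j \<and> j \<noteq> l \<and> i \<noteq> l"
    let ?A = "\<lambda>q\<in>positions (v^3). if sign_cube (v^2) h s q = 1 then 1 else 0"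
    show "block v ?A i j l = block v ?A j l i"
      using r d rot[OF r] by (simp only: block_sign_cube simp_thms)
    show "block v ?A j l i = block v ?A l i j"
      using r d rot[OF r(2,3,1)] by (simp only: block_sign_cube simp_thms not_sym)
  next
    fix i j assume r: "i \<in> {1..v}" "j \<in> {1..v}"
    let ?A = "\<lambda>q\<in>positions (v^3). if sign_cube (v^2) h s q = 1 then 1 else 0"
    show "block v ?A i i j = block v ?A j j i"
      using r assms(2)[of "i - 1" "j - 1"] by (simp only: block_sign_cube)
    show "block v ?A i j i = block v ?A j i j"
      using r assms(3)[of "i - 1" "j - 1"] by (simp only: block_sign_cube)
    show "block v ?A i j j = block v ?A j i i"
      using r assms(4)[of "i - 1" "j - 1"] by (simp only: block_sign_cube)
  qed
qed

section \<open>Sign matrices with prescribed row sums\<close>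

text \<open>Negating columns makes row \<open>0\<close> constantly \<open>-1\<close>; every other
  row is orthogonal to it and has sum zero. Only \<open>e = 0\<close> then contributes to the
  weighted sum, giving \<open>- n^2\<close>.\<close>

lemma normalised_signs:
  assumes h: "orthogonal_signs n h" and n: "n > 0"
  obtains g where "orthogonal_signs n g"
    and "\<And>a. a < n \<Longrightarrow> (\<Sum>e<n. g e a * (\<Sum>b<n. g e b)^2) = - (int n ^ 2)"
proof -
  have h0: "h 0 a \<in> {1, -1}" if "a < n" for a
    using h n that unfolding orthogonal_signs_def by blast
  define g where "g e a = - h 0 a * h e a" for e a
  have "orthogonal_signs n g"
    unfolding g_def using h0 by (intro orthogonal_signs_scale_cols[OF h]) auto
  moreover have "(\<Sum>e<n. g e a * (\<Sum>b<n. g e b)^2) = - (int n ^ 2)" if a: "a < n" for a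
  proof -
    have "(\<Sum>b<n. g e b) = (if e = 0 then - int n else 0)" if "e < n" for e
    proof (cases "e = 0")
      case True
      then show ?thesis
        using orthogonal_signs_row_norm[OF h n] unfolding g_def by (simp add: sum_negf)
    next
      case False
      then have "(\<Sum>b<n. h 0 b * h e b) = 0" using h n that unfolding orthogonal_signs_def by blast
      then show ?thesis using False unfolding g_def by (simp add: sum_negf)
    qed
    then have "(\<Sum>e<n. g e a * (\<Sum>b<n. g e b)^2) = (\<Sum>e<n. if e = 0 then g e a * int n ^ 2 else 0)"
      by (intro sum.cong refl) auto
    also have "\<dots> = g 0 a * int n ^ 2" using n by simp
    also have "g 0 a = -1" using h0[OF a] unfolding g_def by auto
    finally show ?thesis by simp
  qed
  ultimately show thesis by (rule that)
qed

text \<open>The squares of the \<open>n\<close> column sums add up to \<open>n * r^2\<close>;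
  expanded, the products of distinct rows cancel and the row norms leave
  \<open>n * n\<close>.\<close>

lemma regular_row_sum_square:
  assumes h: "orthogonal_signs n h" and n: "n > 0"
    and col: "\<And>a. a < n \<Longrightarrow> (\<Sum>e<n. h e a) = r"
  shows "r^2 = int n"
proof -
  have "int n * r^2 = (\<Sum>a<n. (\<Sum>e<n. h e a)^2)" using col by simp
  also have "\<dots> = (\<Sum>a<n. \<Sum>e<n. \<Sum>e'<n. h e a * h e' a)"
    by (simp add: power2_eq_square sum_product)
  also have "\<dots> = (\<Sum>e<n. \<Sum>a<n. \<Sum>e'<n. h e a * h e' a)" by (rule sum.swap)
  also have "\<dots> = (\<Sum>e<n. \<Sum>e'<n. \<Sum>a<n. h e a * h e' a)"
    by (intro sum.cong refl sum.swap)
  also have "\<dots> = (\<Sum>e<n. \<Sum>e'<n. if e' = e then int n else 0)"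
    using h orthogonal_signs_row_norm[OF h] unfolding orthogonal_signs_def
    by (intro sum.cong refl) auto
  also have "\<dots> = int n * int n" by simp
  finally show ?thesis using n by simp
qed

lemma regular_signs:
  assumes h: "orthogonal_signs (v^2) h" and v: "v > 0"
    and row: "\<And>e. e < v^2 \<Longrightarrow> (\<Sum>a<v^2. h e a) = r"
    and col: "\<And>a. a < v^2 \<Longrightarrow> (\<Sum>e<v^2. h e a) = r"
  obtains g where "orthogonal_signs (v^2) g"
    and "\<And>a. a < v^2 \<Longrightarrow> (\<Sum>e<v^2. g e a * (\<Sum>b<v^2. g e b)^2) = - (int v ^ 3)"
proof -
  have r2: "r^2 = int v ^ 2" using regular_row_sum_square[OF h _ col] v by simp
  then have "r = int v \<or> r = - int v" by (simp add: power2_eq_iff)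
  \<comment> \<open>Negating the whole matrix if necessary makes the common sum
    \<open>- int v\<close>, so that each layer sum becomes
    \<open>- int v * int v ^ 2\<close>.\<close>
  then obtain c :: int where c: "c \<in> {1, -1}" "c * r = - int v" by fastforce
  define g where "g e a = c * h e a" for e a
  have "orthogonal_signs (v^2) g"
    unfolding g_def using c by (intro orthogonal_signs_scale_cols[OF h]) auto
  moreover have "(\<Sum>e<v^2. g e a * (\<Sum>b<v^2. g e b)^2) = - (int v ^ 3)" if a: "a < v^2" for a
  proof -
    have "(\<Sum>b<v^2. g e b) = - int v" if "e < v^2" for e
      unfolding g_def sum_distrib_left[symmetric] row[OF that] by (rule c(2))
    then have "(\<Sum>e<v^2. g e a * (\<Sum>b<v^2. g e b)^2) = (\<Sum>e<v^2. g e a * int v ^ 2)"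
      by (intro sum.cong refl) auto
    also have "\<dots> = (\<Sum>e<v^2. g e a) * int v ^ 2" by (simp add: sum_distrib_right)
    also have "(\<Sum>e<v^2. g e a) = - int v"
      unfolding g_def sum_distrib_left[symmetric] col[OF a] by (rule c(2))
    finally show ?thesis by (simp add: power3_eq_cube power2_eq_square)
  qed
  ultimately show thesis by (rule that)
qed

section \<open>Parameters and assembly\<close>

text \<open>Applied with \<open>r * q = v^6\<close>: once for \<open>r = v^4\<close>,
  \<open>q = v^2\<close> and once for \<open>r = q = v^3\<close>. Divisibility by \<open>4\<close>
  makes both divisions exact, and \<open>q > 1\<close> keeps \<open>q - 2\<close> from being
  truncated.\<close>

lemma cube_parameters:
  fixes r q :: nat
  assumes "4 dvd r" "q > 1"
  shows "2 * int (r * (q - 1) div 2) = int r * int q - int r"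
    and "4 * int (r * (q - 2) div 4) = int r * int q - 2 * int r"
proof -
  have "2 dvd r" using assms(1) by presburger
  then have "2 * (r * (q - 1) div 2) = r * (q - 1)" "4 * (r * (q - 2) div 4) = r * (q - 2)"
    using assms(1) by simp_all
  then have "2 * int (r * (q - 1) div 2) = int r * int (q - 1)"
    "4 * int (r * (q - 2) div 4) = int r * int (q - 2)"
    by (metis of_nat_mult of_nat_numeral)+
  then show "2 * int (r * (q - 1) div 2) = int r * int q - int r"
    "4 * int (r * (q - 2) div 4) = int r * int q - 2 * int r"
    using assms(2) by (simp_all add: of_nat_diff right_diff_distrib)
qed

theorem corollary4p13:
  fixes v :: nat and H :: "int mat"
  assumes "v > 0"
    and "v mod 3 = 0 \<or> v mod 3 = 2"
    and "v \<noteq> 3"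
    and "hadamard_matrix (v^2) H"
  shows "(\<exists>A \<in> C33 (v^3) (v^4 * (v^2 - 1) div 2) (v^4 * (v^2 - 2) div 4). block_symmetric v A) \<and>
    (regular_hadamard_matrix (v^2) H \<longrightarrow>
      (\<exists>A \<in> C33 (v^3) (v^3 * (v^3 - 1) div 2) (v^3 * (v^3 - 2) div 4). block_symmetric v A))"
proof -
  define h where "h e a = H $$ (e, a)" for e a
  have h: "orthogonal_signs (v^2) h"
    unfolding h_def by (rule hadamard_matrix_orthogonal_signs[OF assms(4)])
  have "v \<noteq> 1" using assms(2) by auto
  then have "v > 1" using assms(1) by simp
  then have "v^2 > 1" "v^3 > 1" by (rule one_less_power; simp)+
  \<comment> \<open>Orthogonal rows of length \<open>v^2 > 1\<close> force even length; evenness of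
    \<open>v\<close> is what allows the \<open>v\<close> points to be partitioned into
    pairs.\<close>
  then have even: "even v" using orthogonal_signs_even[OF h] by simp
  then obtain m where m: "v = 2 * m" by blast
  obtain s where s: "latin_cube v s"
    and sym: "\<And>i j l. i \<noteq> j \<Longrightarrow> j \<noteq> l \<Longrightarrow> i \<noteq> l \<Longrightarrow> s i j l = s j l i"
      "\<And>i j. s i i j = s j j i" "\<And>i j. s i j i = s j i j" "\<And>i j. s i j j = s j i i"
    using symmetric_latin_cube[OF even assms(1,2)] by blast
  have cube: "\<exists>A \<in> C33 (v^3) k l. block_symmetric v A"
    if "orthogonal_signs (v^2) g"
      "\<And>a. a < v^2 \<Longrightarrow> (\<Sum>e<v^2. g e a * (\<Sum>b<v^2. g e b)^2) = - t"
      "2 * int k = int v ^ 6 - t" "4 * int l = int v ^ 6 - 2 * t" for g t k l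
    using sign_cube_C33[OF s assms(1) that] sign_cube_block_symmetric[of s v, OF sym] by blast
  have "\<exists>A \<in> C33 (v^3) (v^4 * (v^2 - 1) div 2) (v^4 * (v^2 - 2) div 4). block_symmetric v A"
  proof -
    obtain g where g: "orthogonal_signs (v^2) g"
      "\<And>a. a < v^2 \<Longrightarrow> (\<Sum>e<v^2. g e a * (\<Sum>b<v^2. g e b)^2) = - int (v^4)"
      using normalised_signs[OF h] assms(1) by auto
    have "4 dvd v^4" unfolding m by (simp add: power_mult_distrib)
    from cube_parameters[OF this \<open>v^2 > 1\<close>] show ?thesis
      by (intro cube[OF g]) (simp_all add: power_mult[symmetric] power_add[symmetric])
  qed
  moreover have "\<exists>A \<in> C33 (v^3) (v^3 * (v^3 - 1) div 2) (v^3 * (v^3 - 2) div 4). block_symmetric v A"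
    if reg: "regular_hadamard_matrix (v^2) H"
  proof -
    obtain r where row: "\<And>e. e < v^2 \<Longrightarrow> (\<Sum>a<v^2. h e a) = r"
      and col: "\<And>a. a < v^2 \<Longrightarrow> (\<Sum>e<v^2. h e a) = r"
      using reg unfolding regular_hadamard_matrix_def h_def by blast
    obtain g where g: "orthogonal_signs (v^2) g"
      "\<And>a. a < v^2 \<Longrightarrow> (\<Sum>e<v^2. g e a * (\<Sum>b<v^2. g e b)^2) = - int (v^3)"
      using regular_signs[OF h assms(1) row col] by auto
    have "4 dvd v^3" unfolding m by (simp add: power_mult_distrib)
    from cube_parameters[OF this \<open>v^3 > 1\<close>] show ?thesis
      by (intro cube[OF g]) (simp_all add: power_add[symmetric])
  qed
  ultimately show ?thesis by blast
qed

end
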